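(* Let $\mathcal{H}=\mathcal{H}_K\oplus\mathcal{H}_M$ be an orthogonal decomposition of a Hilbert space $\mathcal{H}$. Let $\Phi_1$ and $\Phi_2$ be (the analysis operators of) Parseval frames for $\mathcal{H}$ with index sets $I_1$, $I_2$, respectively. Suppose $x^0\in\mathcal{H}$ may be decomposed as $x^0=x_1^0+x_2^0$ and for $\delta\ge 0$ there exist some $\Lambda_1\subset I_1$, $\Lambda_2\subset I_2$ such that the following $\delta$-sparsity condition is satisfied: $$\|\mathbf{1}_{\Lambda_1^c}\Phi_1x_1^0\|_1+\|\mathbf{1}_{\Lambda_2^c}\Phi_2x_2^0\|_1\le\delta .$$ Let $P_K$, $P_M$ be the orthogonal projections onto $\mathcal{H}_K$, $\mathcal{H}_M$, respectively, and let the joint concentration (with respect to $\Lambda_1$ and $\Lambda_2$) $\kappa$ be defined as $$\kappa=\sup_{x\in\mathcal{H},\ y\in\mathcal{H}_M}\frac{\|\mathbf{1}_{\Lambda_1}\Phi_1(y+P_Kx)\|_1+\|\mathbf{1}_{\Lambda_2}\Phi_2x\|_1}{\|\Phi_1(y+P_Kx)\|_1+\|\Phi_2x\|_1}.$$ Suppose $(x_1^\star,x_2^\star)$ solves the constrained optimization problem $$(x_1^\star,x_2^\star)=\operatorname*{arg\,min}_{(x_1,x_2)}\ \|\Phi_1x_1\|_1+\|\Phi_2x_2\|_1\quad\text{subject to}\quad P_K(x_1+x_2)=P_K(x^0).$$ Then $$\|x_1^\star-x_1^0\|_2+\|x_2^\star-x_2^0\|_2\le\frac{2\delta}{1-2\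kappa}.$$
   Context: For a Hilbert space $\mathcal{H}$ and a coefficient index set $I$, a Parseval frame (more precisely, the analysis operator of a Parseval frame) $\Phi:\mathcal{H}\to\ell^2(I)$ is such that $\|\Phi x\|_2=\|x\|_{\mathcal{H}}$ for all $x\in\mathcal{H}$. For $\Lambda\subset I$, $\Lambda^c=I\setminus\Lambda$ is the complement and $\mathbf{1}_\Lambda$ is the function that is $1$ on $\Lambda$ and $0$ off $\Lambda$; $\mathbf{1}_\Lambda\Phi x$ is the pointwise product. $\|\cdot\|_1$ denotes the $\ell^1$ norm of a coefficient sequence, and $\|\cdot\|_2$ applied to an element of $\mathcal{H}$ denotes the norm of $\mathcal{H}$. In the optimization problem, $x_1,x_2$ range over $\mathcal{H}$. $\mathcal{H}_K$ represents the known part of the data and $\mathcal{H}_M$ the missing part to be reconstructed.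
   Formalization: The formal theorem adds that κ < 1/2 (otherwise the bound is negative or divides by zero) and that ‖Φ₁x₁⁰‖₁ and ‖Φ₂x₂⁰‖₁ are finite (otherwise κ involves ∞/∞); quotients 0/0 and ∞/∞ in κ are ignored. *)

theory Defs
  imports "HOL-Analysis.Analysis"
begin

text \<open>
  Hilbert spaces are types of sort \<open>{real_inner, complete_space}\<close>, coefficients live in an arbitrary
  \<open>'k :: real_normed_field\<close>, and analysis operators are only required to be real-linear.  This
  covers real and complex scalars at once: a complex Hilbert space with inner product
  \<open>\<langle>x, y\<rangle>\<close> is a real one with inner product \<open>Re \<langle>x, y\<rangle>\<close> and the same norm; complex-linear maps
  are real-linear, and for complex subspaces orthogonality and orthogonal projections with respect
  to the two inner products coincide.
\<close>

definition l1_norm :: "'i set \<Rightarrow> ('i \<Rightarrow> 'k::real_normed_field) \<Rightarrow> ennreal" where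
  "l1_norm I c = (\<Sum>\<^sub>\<infinity>i\<in>I. ennreal (norm (c i)))"

definition l2_norm :: "'i set \<Rightarrow> ('i \<Rightarrow> 'k::real_normed_field) \<Rightarrow> real" where
  "l2_norm I c = sqrt (\<Sum>\<^sub>\<infinity>i\<in>I. (norm (c i))\<^sup>2)"

text \<open>
  A linear isometry \<open>\<Phi>\<close> into the square-summable families over \<open>I\<close>; values \<open>\<Phi> x i\<close> with \<open>i \<notin> I\<close>
  are irrelevant.  The frame vectors are the Riesz representers of the (automatically bounded)
  functionals \<open>\<lambda>x. \<Phi> x i\<close>.
\<close>

definition parseval_frame ::
  "'i set \<Rightarrow> ('h::{real_inner, complete_space} \<Rightarrow> 'i \<Rightarrow> 'k::real_normed_field) \<Rightarrow> bool" where
  "parseval_frame I \<Phi> \<longleftrightarrow>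
     (\<forall>i\<in>I. linear (\<lambda>x. \<Phi> x i)) \<and>
     (\<forall>x. (\<lambda>i. (norm (\<Phi> x i))\<^sup>2) summable_on I \<and> l2_norm I (\<Phi> x) = norm x)"

definition orthogonal_decomposition :: "'h::{real_inner, complete_space} set \<Rightarrow> 'h set \<Rightarrow> bool" where
  "orthogonal_decomposition HK HM \<longleftrightarrow>
     subspace HK \<and> closed HK \<and> subspace HM \<and> closed HM \<and>
     (\<forall>u\<in>HK. \<forall>v\<in>HM. orthogonal u v) \<and>
     (\<forall>x. \<exists>u\<in>HK. \<exists>v\<in>HM. x = u + v)"

definition orth_proj :: "'h::{real_inner, complete_space} set \<Rightarrow> 'h \<Rightarrow> 'h" where
  "orth_proj S x = (THE p. p \<in> S \<and> (\<forall>s\<in>S. orthogonal (x - p) s))"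

abbreviation restrict_coeffs :: "'i set \<Rightarrow> ('i \<Rightarrow> 'k::real_normed_field) \<Rightarrow> 'i \<Rightarrow> 'k" where
  "restrict_coeffs \<Lambda> c \<equiv> (\<lambda>i. indicator \<Lambda> i * c i)"

text \<open>
  In \<open>ennreal\<close> the indeterminate quotients \<open>0 / 0\<close> and \<open>\<infinity> / \<infinity>\<close> are \<open>0\<close>, so the
  supremum is effectively over the pairs \<open>(x, y)\<close> for which the quotient makes sense.  The numerator
  never exceeds the denominator, so the value is at most \<open>1\<close>.
\<close>

definition joint_concentration ::
  "'i set \<Rightarrow> ('h::{real_inner, complete_space} \<Rightarrow> 'i \<Rightarrow> 'k::real_normed_field) \<Rightarrow> 'i set \<Rightarrow>
   'j set \<Rightarrow> ('h \<Rightarrow> 'j \<Rightarrow> 'k) \<Rightarrow> 'j set \<Rightarrow> 'h set \<Rightarrow> 'h set \<Rightarrow> ennreal" where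
  "joint_concentration I\<^sub>1 \<Phi>\<^sub>1 \<Lambda>\<^sub>1 I\<^sub>2 \<Phi>\<^sub>2 \<Lambda>\<^sub>2 HK HM =
     (SUP (x, y) \<in> UNIV \<times> HM.
        (l1_norm I\<^sub>1 (restrict_coeffs \<Lambda>\<^sub>1 (\<Phi>\<^sub>1 (y + orth_proj HK x)))
           + l1_norm I\<^sub>2 (restrict_coeffs \<Lambda>\<^sub>2 (\<Phi>\<^sub>2 x)))
        / (l1_norm I\<^sub>1 (\<Phi>\<^sub>1 (y + orth_proj HK x)) + l1_norm I\<^sub>2 (\<Phi>\<^sub>2 x)))"

end

theory Submission
  imports Defs
begin

text \<open>
  Put \<open>h\<^sub>1 = xs\<^sub>1 - x0\<^sub>1\<close> and \<open>h\<^sub>2 = x0\<^sub>2 - xs\<^sub>2\<close>, with opposite orientations.  Feasibility makes the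
  \<open>HK\<close>-components of \<open>h\<^sub>1\<close> and \<open>h\<^sub>2\<close> agree, so \<open>h\<^sub>1 = y + P\<^sub>K h\<^sub>2\<close> with \<open>y \<in> HM\<close>, and \<open>(h\<^sub>2, y)\<close> is
  a competitor in the definition of \<open>\<kappa>\<close>.  Writing \<open>N\<close> for the total \<open>\<ell>\<^sup>1\<close> norm of the coefficients of
  \<open>(h\<^sub>1, h\<^sub>2)\<close> and \<open>S\<close> for its part on the sets \<open>\<Lambda>\<close>, we get \<open>S \<le> \<kappa> N\<close>, whereas minimality and the
  triangle inequality give \<open>N \<le> 2 S + 2 \<delta>\<close>.  Hence \<open>N \<le> 2 \<delta> / (1 - 2 \<kappa>)\<close>, and the \<open>\<ell>\<^sup>1\<close> norm
  dominates the \<open>\<ell>\<^sup>2\<close> norm.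
\<close>

lemma l1_norm_add:
  "l1_norm I c + l1_norm I d = (\<Sum>\<^sub>\<infinity>i\<in>I. ennreal (norm (c i) + norm (d i)))"
  unfolding l1_norm_def
  by (subst infsum_add[symmetric]) (auto intro: nonneg_summable_on_complete simp: ennreal_plus)

text \<open>Only the norms of \<open>h\<close> are prescribed, so the lemma serves both orientations
  of the difference.\<close>

lemma l1_norm_triangle:
  assumes "\<And>i. i \<in> I \<Longrightarrow> norm (h i) = norm (a i - b i)"
  shows "l1_norm I h \<le> l1_norm I a + l1_norm I b"
  unfolding l1_norm_add unfolding l1_norm_def
  by (rule infsum_mono)
    (auto intro!: nonneg_summable_on_complete ennreal_leI norm_triangle_ineq4 simp: assms
      simp flip: ennreal_plus)

text \<open>
  The usual cone inequality, with the terms arranged so that no subtraction in \<open>ennreal\<close> occurs.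
\<close>
lemma l1_norm_cone:
  fixes a b h :: "'i \<Rightarrow> 'k::real_normed_field"
  assumes h: "\<And>i. i \<in> I \<Longrightarrow> norm (h i) = norm (a i - b i)"
  shows "l1_norm I h + l1_norm I b \<le>
    2 * l1_norm I (restrict_coeffs \<Lambda> h) + l1_norm I a + 2 * l1_norm I (restrict_coeffs (I - \<Lambda>) b)"
proof -
  let ?p = "restrict_coeffs \<Lambda> h" and ?q = "restrict_coeffs (I - \<Lambda>) b"
  have "l1_norm I h + l1_norm I b \<le>
     (\<Sum>\<^sub>\<infinity>i\<in>I. ennreal (norm (?p i) + norm (?p i)) + ennreal (norm (a i))
        + ennreal (norm (?q i) + norm (?q i)))"
    unfolding l1_norm_add
  proof (rule infsum_mono)
    fix i assume i: "i \<in> I"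
    \<comment> \<open>On \<Lambda>, \<open>b\<close> is at most \<open>a\<close> plus
      \<open>h\<close> in norm, which yields the second copy of \<open>h\<close>. Off \<Lambda>,
      \<open>h\<close> is at most \<open>a\<close> plus \<open>b\<close>, which yields the second
      copy of \<open>b\<close>.\<close>
    have "norm (h i) + norm (b i) \<le> norm (?p i) + norm (?p i) + norm (a i) + (norm (?q i) + norm (?q i))"
    proof (cases "i \<in> \<Lambda>")
      case True
      with norm_triangle_ineq2[of "b i" "a i"] show ?thesis
        by (simp add: h[OF i] norm_minus_commute)
    next
      case False
      with norm_triangle_ineq4[of "a i" "b i"] i show ?thesis
        by (simp add: h[OF i])
    qed
    then show "ennreal (norm (h i) + norm (b i)) \<le>
        ennreal (norm (?p i) + norm (?p i)) + ennreal (norm (a i)) + ennreal (norm (?q i) + norm (?q i))"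
      by (simp add: ennreal_plus[symmetric] ennreal_leI del: ennreal_plus)
  qed (auto intro: nonneg_summable_on_complete)
  also have "\<dots> = (l1_norm I ?p + l1_norm I ?p) + l1_norm I a + (l1_norm I ?q + l1_norm I ?q)"
    unfolding l1_norm_add unfolding l1_norm_def
    by (simp add: infsum_add nonneg_summable_on_complete del: ennreal_plus)
  finally show ?thesis by (simp add: mult_2)
qed

text \<open>If the right-hand side is a finite \<open>T\<close>, every coefficient has norm at most
  \<open>T\<close>, so the sum of squares is at most \<open>T\<close> times the sum of norms, hence
  at most \<open>T\<close> squared.\<close>

lemma l2_norm_le_l1_norm: "ennreal (l2_norm I c) \<le> l1_norm I c"
proof (cases "l1_norm I c")
  case (real T)
  have "(\<Sum>\<^sub>\<infinity>i\<in>I. (norm (c i))\<^sup>2) \<le> T\<^sup>2"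
  proof (cases "(\<lambda>i. (norm (c i))\<^sup>2) summable_on I")
    case True
    then show ?thesis
    proof (rule infsum_le_finite_sums)
      fix F assume F: "finite F" "F \<subseteq> I"
      have "ennreal (\<Sum>i\<in>F. norm (c i)) = (\<Sum>i\<in>F. ennreal (norm (c i)))"
        by simp
      also have "\<dots> \<le> ennreal T"
        unfolding real(2)[symmetric] l1_norm_def
        using infsum_mono_neutral[of "\<lambda>i. ennreal (norm (c i))" F "\<lambda>i. ennreal (norm (c i))" I] F
        by (auto simp: nonneg_summable_on_complete)
      finally have le: "(\<Sum>i\<in>F. norm (c i)) \<le> T"
        using real(1) by simp
      have "(\<Sum>i\<in>F. (norm (c i))\<^sup>2) \<le> (\<Sum>i\<in>F. T * norm (c i))"
      proof (rule sum_mono)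
        fix i assume "i \<in> F"
        then have "norm (c i) \<le> T"
          using member_le_sum[of i F "\<lambda>i. norm (c i)"] F le by fastforce
        then show "(norm (c i))\<^sup>2 \<le> T * norm (c i)"
          by (simp add: power2_eq_square mult_right_mono)
      qed
      also have "\<dots> \<le> T\<^sup>2"
        using le real(1) by (simp add: sum_distrib_left[symmetric] power2_eq_square mult_left_mono)
      finally show "(\<Sum>i\<in>F. (norm (c i))\<^sup>2) \<le> T\<^sup>2" .
    qed
  next
    \<comment> \<open>Without summability the infinite sum takes its default value 0.\<close>
    case False
    then show ?thesis by (simp add: infsum_not_exists)
  qed
  then have "l2_norm I c \<le> T"
    unfolding l2_norm_def using real(1) real_le_lsqrt by blast
  with real show ?thesis by (simp add: ennreal_leI)
qed simp

lemma parseval_frame_norm_le: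
  "parseval_frame I \<Phi> \<Longrightarrow> ennreal (norm x) \<le> l1_norm I (\<Phi> x)"
  using l2_norm_le_l1_norm[of I "\<Phi> x"] by (simp add: parseval_frame_def)

lemma parseval_frame_diff:
  "parseval_frame I \<Phi> \<Longrightarrow> i \<in> I \<Longrightarrow> \<Phi> (x - y) i = \<Phi> x i - \<Phi> y i"
  unfolding parseval_frame_def by (metis linear_diff)

lemma orth_proj_eqI:
  assumes dec: "orthogonal_decomposition HK HM" and u: "u \<in> HK" and v: "v \<in> HM"
  shows "orth_proj HK (u + v) = u"
  unfolding orth_proj_def
proof (rule the_equality)
  show "u \<in> HK \<and> (\<forall>s\<in>HK. orthogonal (u + v - u) s)"
    using dec u v by (auto simp: orthogonal_decomposition_def orthogonal_commute)
next
  fix p assume p: "p \<in> HK \<and> (\<forall>s\<in>HK. orthogonal (u + v - p) s)"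
  have up: "u - p \<in> HK"
    using dec p u by (auto simp: orthogonal_decomposition_def intro: subspace_diff)
  \<comment> \<open>Uniqueness: \<open>u - p\<close> lies in \<open>HK\<close> and is orthogonal to
    both \<open>u + v - p\<close> and \<open>v\<close>, hence to itself.\<close>
  then have "inner (u + v - p) (u - p) = 0" "inner v (u - p) = 0"
    using dec p v by (auto simp: orthogonal_decomposition_def orthogonal_def inner_commute)
  then have "inner (u - p) (u - p) = 0"
    by (simp add: inner_diff_left inner_add_left)
  then show "p = u" by simp
qed

text \<open>This turns feasibility into a pair admissible for the joint concentration. Splitting all
  vectors along \<open>HK\<close> and \<open>HM\<close>, equality of the projections forces the
  \<open>HK\<close>-components of the two oppositely oriented differences to agree; \<open>y\<close>
  is the remaining \<open>HM\<close>-component.\<close>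

lemma orth_proj_add_diff:
  assumes dec: "orthogonal_decomposition HK HM"
    and eq: "orth_proj HK (x\<^sub>1 + x\<^sub>2) = orth_proj HK (z\<^sub>1 + z\<^sub>2)"
  obtains y where "y \<in> HM" "x\<^sub>1 - z\<^sub>1 = y + orth_proj HK (z\<^sub>2 - x\<^sub>2)"
proof -
  have sub: "subspace HK" "subspace HM"
    and ex: "\<And>x. \<exists>u\<in>HK. \<exists>v\<in>HM. x = u + v"
    using dec by (auto simp: orthogonal_decomposition_def)
  obtain u v where uv: "u \<in> HK" "v \<in> HM" "x\<^sub>1 - z\<^sub>1 = u + v" using ex by blast
  obtain u' v' where uv': "u' \<in> HK" "v' \<in> HM" "z\<^sub>2 - x\<^sub>2 = u' + v'" using ex by blast
  obtain a b where ab: "a \<in> HK" "b \<in> HM" "z\<^sub>1 + z\<^sub>2 = a + b" using ex by blast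
  have "x\<^sub>1 + x\<^sub>2 = (z\<^sub>1 + z\<^sub>2) + (x\<^sub>1 - z\<^sub>1) - (z\<^sub>2 - x\<^sub>2)" by simp
  also have "\<dots> = (a + (u - u')) + (b + (v - v'))"
    by (simp only: uv uv' ab) (simp add: algebra_simps)
  finally have "orth_proj HK (x\<^sub>1 + x\<^sub>2) = a + (u - u')"
    using uv uv' ab sub
    by (simp only:) (intro orth_proj_eqI[OF dec] subspace_add subspace_diff)
  moreover have "orth_proj HK (z\<^sub>1 + z\<^sub>2) = a" "orth_proj HK (z\<^sub>2 - x\<^sub>2) = u'"
    unfolding ab(3) uv'(3) using ab uv' by (auto intro: orth_proj_eqI[OF dec])
  ultimately have "u = orth_proj HK (z\<^sub>2 - x\<^sub>2)" using eq by simp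
  then show ?thesis using that[OF uv(2)] uv(3) by (simp add: add.commute)
qed

text \<open>The pair \<open>(x, y)\<close> is one of the competitors in the supremum. As
  \<open>N\<close> is finite and nonzero, the quotient in \<open>ennreal\<close> can be multiplied
  back by \<open>N\<close>.\<close>

lemma joint_concentration_bound:
  fixes I\<^sub>1 \<Phi>\<^sub>1 I\<^sub>2 \<Phi>\<^sub>2 HK x y
  defines "N \<equiv> l1_norm I\<^sub>1 (\<Phi>\<^sub>1 (y + orth_proj HK x)) + l1_norm I\<^sub>2 (\<Phi>\<^sub>2 x)"
  assumes "y \<in> HM" and fin: "N < \<infinity>"
    and pos: "N \<noteq> 0"
  shows "l1_norm I\<^sub>1 (restrict_coeffs \<Lambda>\<^sub>1 (\<Phi>\<^sub>1 (y + orth_proj HK x)))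
           + l1_norm I\<^sub>2 (restrict_coeffs \<Lambda>\<^sub>2 (\<Phi>\<^sub>2 x))
         \<le> joint_concentration I\<^sub>1 \<Phi>\<^sub>1 \<Lambda>\<^sub>1 I\<^sub>2 \<Phi>\<^sub>2 \<Lambda>\<^sub>2 HK HM * N"
    (is "?S \<le> ?\<kappa> * N")
proof -
  have "?S / N \<le> ?\<kappa>"
    unfolding joint_concentration_def N_def
    by (rule SUP_upper2[where i = "(x, y)"]) (use assms(2) in auto)
  then have "?S / N * N \<le> ?\<kappa> * N"
    by (rule mult_right_mono) simp
  then show ?thesis
    using fin pos by (simp add: ennreal_divide_times ennreal_mult_divide_eq less_top[symmetric])
qed

theorem theorem0p1:
  fixes HK HM :: "'h::{real_inner, complete_space} set"
    and I\<^sub>1 \<Lambda>\<^sub>1 :: "'i set" and I\<^sub>2 \<Lambda>\<^sub>2 :: "'j set"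
    and \<Phi>\<^sub>1 :: "'h \<Rightarrow> 'i \<Rightarrow> 'k::real_normed_field"
    and \<Phi>\<^sub>2 :: "'h \<Rightarrow> 'j \<Rightarrow> 'k"
    and x0 x0\<^sub>1 x0\<^sub>2 xs\<^sub>1 xs\<^sub>2 :: 'h
    and \<delta> :: real and \<kappa> :: ennreal
  defines "\<kappa> \<equiv> joint_concentration I\<^sub>1 \<Phi>\<^sub>1 \<Lambda>\<^sub>1 I\<^sub>2 \<Phi>\<^sub>2 \<Lambda>\<^sub>2 HK HM"
  assumes "orthogonal_decomposition HK HM"
    and "parseval_frame I\<^sub>1 \<Phi>\<^sub>1" and "parseval_frame I\<^sub>2 \<Phi>\<^sub>2"
    and "x0 = x0\<^sub>1 + x0\<^sub>2"
    and "l1_norm I\<^sub>1 (\<Phi>\<^sub>1 x0\<^sub>1) < \<infinity>" and "l1_norm I\<^sub>2 (\<Phi>\<^sub>2 x0\<^sub>2) < \<infinity>"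
    and "\<delta> \<ge> 0" and "\<Lambda>\<^sub>1 \<subseteq> I\<^sub>1" and "\<Lambda>\<^sub>2 \<subseteq> I\<^sub>2"
    and "l1_norm I\<^sub>1 (restrict_coeffs (I\<^sub>1 - \<Lambda>\<^sub>1) (\<Phi>\<^sub>1 x0\<^sub>1))
           + l1_norm I\<^sub>2 (restrict_coeffs (I\<^sub>2 - \<Lambda>\<^sub>2) (\<Phi>\<^sub>2 x0\<^sub>2)) \<le> ennreal \<delta>"
    and "\<kappa> < 1 / 2"
    and "is_arg_min (\<lambda>(x\<^sub>1, x\<^sub>2). l1_norm I\<^sub>1 (\<Phi>\<^sub>1 x\<^sub>1) + l1_norm I\<^sub>2 (\<Phi>\<^sub>2 x\<^sub>2))
           (\<lambda>(x\<^sub>1, x\<^sub>2). orth_proj HK (x\<^sub>1 + x\<^sub>2) = orth_proj HK x0)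
           (xs\<^sub>1, xs\<^sub>2)"
  shows "norm (xs\<^sub>1 - x0\<^sub>1) + norm (xs\<^sub>2 - x0\<^sub>2) \<le> 2 * \<delta> / (1 - 2 * enn2real \<kappa>)"
proof -
  let ?h1 = "xs\<^sub>1 - x0\<^sub>1" and ?h2 = "x0\<^sub>2 - xs\<^sub>2"
  let ?N = "l1_norm I\<^sub>1 (\<Phi>\<^sub>1 ?h1) + l1_norm I\<^sub>2 (\<Phi>\<^sub>2 ?h2)"
  let ?S = "l1_norm I\<^sub>1 (restrict_coeffs \<Lambda>\<^sub>1 (\<Phi>\<^sub>1 ?h1)) + l1_norm I\<^sub>2 (restrict_coeffs \<Lambda>\<^sub>2 (\<Phi>\<^sub>2 ?h2))"
  let ?X = "l1_norm I\<^sub>1 (\<Phi>\<^sub>1 xs\<^sub>1) + l1_norm I\<^sub>2 (\<Phi>\<^sub>2 xs\<^sub>2)"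
  let ?Z = "l1_norm I\<^sub>1 (\<Phi>\<^sub>1 x0\<^sub>1) + l1_norm I\<^sub>2 (\<Phi>\<^sub>2 x0\<^sub>2)"
  let ?D = "l1_norm I\<^sub>1 (restrict_coeffs (I\<^sub>1 - \<Lambda>\<^sub>1) (\<Phi>\<^sub>1 x0\<^sub>1))
           + l1_norm I\<^sub>2 (restrict_coeffs (I\<^sub>2 - \<Lambda>\<^sub>2) (\<Phi>\<^sub>2 x0\<^sub>2))"
  note dec = assms(2) and frame1 = assms(3) and frame2 = assms(4)
  \<comment> \<open>The pair \<open>(x0\<^sub>1, x0\<^sub>2)\<close> is itself feasible, so the
    minimal value is at most \<open>?Z\<close>.\<close>
  have feas: "orth_proj HK (xs\<^sub>1 + xs\<^sub>2) = orth_proj HK (x0\<^sub>1 + x0\<^sub>2)"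
    and min: "?X \<le> ?Z"
    using assms(13) unfolding is_arg_min_def assms(5) by (auto simp: not_less)
  have finZ: "?Z < \<infinity>" using assms(6,7) by simp
  have d1: "norm (\<Phi>\<^sub>1 ?h1 i) = norm (\<Phi>\<^sub>1 xs\<^sub>1 i - \<Phi>\<^sub>1 x0\<^sub>1 i)" if "i \<in> I\<^sub>1" for i
    by (simp add: parseval_frame_diff[OF frame1 that])
  have d2: "norm (\<Phi>\<^sub>2 ?h2 i) = norm (\<Phi>\<^sub>2 xs\<^sub>2 i - \<Phi>\<^sub>2 x0\<^sub>2 i)" if "i \<in> I\<^sub>2" for i
    by (simp add: parseval_frame_diff[OF frame2 that] norm_minus_commute)
  have "?N \<le> ?X + ?Z"
    using add_mono[OF l1_norm_triangle[of I\<^sub>1, OF d1] l1_norm_triangle[of I\<^sub>2, OF d2]]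
    by (simp add: ac_simps)
  also have "\<dots> < \<infinity>"
    using le_less_trans[OF min finZ] finZ by simp
  finally have finN: "?N < \<infinity>" .
  obtain y where y: "y \<in> HM" "?h1 = y + orth_proj HK ?h2"
    using orth_proj_add_diff[OF dec feas] by blast
  have S: "?S \<le> \<kappa> * ?N" if "?N \<noteq> 0"
    using joint_concentration_bound[of y HM I\<^sub>1 \<Phi>\<^sub>1 HK ?h2 I\<^sub>2 \<Phi>\<^sub>2] y finN that
    unfolding \<kappa>_def by simp
  have "?N + ?Z \<le> 2 * ?S + ?X + 2 * ?D"
    using add_mono[OF l1_norm_cone[of I\<^sub>1, OF d1, where \<Lambda> = "\<Lambda>\<^sub>1"]
        l1_norm_cone[of I\<^sub>2, OF d2, where \<Lambda> = "\<Lambda>\<^sub>2"]]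
    by (simp add: algebra_simps)
  also have "\<dots> \<le> 2 * ?S + ?Z + 2 * ennreal \<delta>"
    using min assms(11) by (intro add_mono[OF add_mono[OF order_refl min]] mult_left_mono) auto
  finally have "?Z + ?N \<le> ?Z + (2 * ?S + 2 * ennreal \<delta>)"
    by (simp add: ac_simps)
  \<comment> \<open>Cancelling \<open>?Z\<close> is legitimate in \<open>ennreal\<close> because it
    is finite.\<close>
  then have N: "?N \<le> 2 * ?S + 2 * ennreal \<delta>"
    using finZ by (auto simp: ennreal_add_left_cancel_le)
  obtain k where k: "\<kappa> = ennreal k" "k \<ge> 0" "2 * k < 1"
  proof (cases \<kappa>)
    case (real r)
    have "ennreal (1 / 2) = 1 / 2"
      using divide_ennreal[of 1 2] by (simp only: ennreal_1 ennreal_numeral)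
    then have "ennreal r < ennreal (1 / 2)"
      using assms(12) real by simp
    then have "r < 1 / 2"
      using ennreal_less_iff[OF real(1)] by blast
    then show ?thesis using that[of r] real by simp
  qed (use assms(12) in simp)
  obtain n where n: "?N = ennreal n" "n \<ge> 0"
    using finN by (cases ?N) auto
  \<comment> \<open>For nonzero \<open>n\<close>, insert \<open>S\<close> into \<open>N\<close> and
    pass to the reals to solve for \<open>n\<close>. For \<open>n = 0\<close>, where no quotient
    bound is available, the claim is just \<delta> \<ge> 0.\<close>
  have "n * (1 - 2 * k) \<le> 2 * \<delta>"
  proof (cases "n = 0")
    case False
    then have "?S \<le> \<kappa> * ennreal n"
      using S n by simp
    then have "2 * ?S + 2 * ennreal \<delta> \<le> 2 * (\<kappa> * ennreal n) + 2 * ennreal \<delta>"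
      by (intro add_right_mono mult_left_mono) auto
    with N have "ennreal n \<le> 2 * (\<kappa> * ennreal n) + 2 * ennreal \<delta>"
      unfolding n(1) by (rule order_trans)
    also have "\<dots> = ennreal (2 * (k * n) + 2 * \<delta>)"
      using k n assms(8) by (simp add: ennreal_mult ennreal_plus)
    finally have "n \<le> 2 * (k * n) + 2 * \<delta>"
      using k n assms(8) by (subst (asm) ennreal_le_iff) auto
    then show ?thesis by (simp add: algebra_simps)
  qed (use assms(8) in simp)
  then have "n \<le> 2 * \<delta> / (1 - 2 * k)"
    using k by (simp add: field_simps)
  have "ennreal (norm ?h1 + norm ?h2) \<le> ennreal n"
    using add_mono[OF parseval_frame_norm_le[OF frame1, of ?h1]
        parseval_frame_norm_le[OF frame2, of ?h2]]
    by (simp add: n ennreal_plus)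
  then have "norm ?h1 + norm ?h2 \<le> n"
    by (rule ennreal_le_iff[OF n(2), THEN iffD1])
  also note \<open>n \<le> _\<close>
  finally show ?thesis
    using k by (simp add: norm_minus_commute)
qed

end
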